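(* Suppose that $\bm{\psi}:\mathbb{R}^n\to\mathbb{R}_+$ is a convex function and that, for each $j\in\mathbb{N}_d$, $\mathbf{B}_j$ is an $m_j\times n$ real matrix. Let $\mathbf{B}$ be the block matrix obtained by stacking $\mathbf{B}_1,\dots,\mathbf{B}_d$, with rank $r$, and let $\mathbf{B}'$ be the associated $n\times(p_d+n-r)$ matrix described in the context. Let $\lambda_j>0$, $j\in\mathbb{N}_d$. Let $\mathbf{u}^*\in\mathbb{R}^n$ be such that for each $j\in\mathbb{N}_d$, $$\mathbf{B}_j\mathbf{u}^*=\sum_{i\in\mathbb{N}_{l_j}}z^*_{p_{j-1}+k_i}\mathbf{e}_{m_j,k_i}\in\Omega_{m_j,l_j}\quad\text{for some } l_j\in\mathbb{Z}_{m_j+1}.$$ Then $\mathbf{u}^*$ is a solution of $$\min\Big\{\bm{\psi}(\mathbf{u})+\sum_{j\in\mathbb{N}_d}\lambda_j\|\mathbf{B}_j\mathbf{u}\|_1:\mathbf{u}\in\mathbb{R}^n\Big\}$$ if and only if there exist $\mathbf{a}\in\partial\bm{\psi}(\mathbf{u}^* )$ and $\mathbf{b}:=[b_j:j\in\mathbb{N}_{p_d}]\in\mathcal{N}(\mathbf{B}^\top)$ such that $$(\mathbf{B}'_{(i)})^\top\mathbf{a}=0,\quad i\in\mathbb{N}_{p_d+n-r}\setminus\mathbb{N}_{p_d},$$ and for each $j\in\mathbb{N}_d$ $$\lambda_j=-\big((\mathbf{B}'_{(p_{j-1}+k_i)})^\top\mathbf{a}+b_{p_{j-1}+k_i}\big)\,\mathrm{sign}(z^*_{p_{j-1}+k_i}),\quad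 i\in\mathbb{N}_{l_j},$$ $$\lambda_j\ge\big|(\mathbf{B}'_{(p_{j-1}+i)})^\top\mathbf{a}+b_{p_{j-1}+i}\big|,\quad i\in\mathbb{N}_{m_j}\setminus\{k_i:i\in\mathbb{N}_{l_j}\}.$$
   Context: Notation: $\mathbb{N}_m:=\{1,\dots,m\}$, $\mathbb{N}_0:=\emptyset$, $\mathbb{Z}_s:=\{0,1,\dots,s-1\}$, $\mathbb{R}_+:=[0,+\infty)$. Let $n,d\in\mathbb{N}$, $m_j\in\mathbb{N}$ for $j\in\mathbb{N}_d$, $p_0:=0$ and $p_j:=\sum_{i\in\mathbb{N}_j}m_i$. $\mathbf{e}_{s,i}$ is the $i$-th canonical basis vector of $\mathbb{R}^s$, and $\Omega_{s,l}$ is the set of vectors in $\mathbb{R}^s$ having exactly $l$ nonzero components. Writing a vector as $\sum_{i\in\mathbb{N}_{l}}x_{k_i}\mathbf{e}_{s,k_i}\in\Omega_{s,l}$ means that $1\le k_1<\dots<k_l\le s$ and all $x_{k_i}\neq0$; the indices $k_i$ for block $j$ depend on $j$. $\mathcal{N}(\mathbf{M})$ is the null space and $\mathbf{M}_{(i)}$ the $i$-th column of a matrix $\mathbf{M}$. $\partial$ denotes the convex subdifferential. Matrices: $\mathbf{B}\in\mathbb{R}^{p_d\times n}$ is the matrix whose successive row blocks are $\mathbf{B}_1,\dots,\mathbf{B}_d$; its rank is $r$ with $0<r\le\min\{p_d,n\}$. Fix a singular value decomposition $\mathbf{B}=\mathbf{U}\mathbf{\Lambda}\mathbf{V}^\top$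 with $\mathbf{U}$ ($p_d\times p_d$) and $\mathbf{V}$ ($n\times n$) orthogonal and $\mathbf{\Lambda}$ the $p_d\times n$ diagonal matrix with nonzero diagonal entries $\sigma_1\ge\dots\ge\sigma_r>0$. Let $\widetilde{\mathbf{U}}_r\in\mathbb{R}^{p_d\times r}$ consist of the first $r$ columns of $\mathbf{U}$, let $\mathbf{U}':=\mathrm{diag}(\widetilde{\mathbf{U}}_r^\top,\mathbf{I}_{n-r})\in\mathbb{R}^{n\times(p_d+n-r)}$ (block diagonal), $\mathbf{\Lambda}':=\mathrm{diag}(\sigma_1^{-1},\dots,\sigma_r^{-1},1,\dots,1)\in\mathbb{R}^{n\times n}$, and $\mathbf{B}':=\mathbf{V}\mathbf{\Lambda}'\mathbf{U}'\in\mathbb{R}^{n\times(p_d+n-r)}$. *)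

theory Defs
  imports "Jordan_Normal_Form.DL_Rank" "Jordan_Normal_Form.Matrix_Kernel"
begin

(* Dimensions vary inside the statement (block sizes m j, rank r), so vectors and matrices are
   the dimension-carrying ones of Jordan_Normal_Form, and R^n is carrier_vec n.  All indices are
   0-based: blocks are j < d, entries of a vector of R^s are i < s. *)

definition convex_fun_on_vec :: "nat \<Rightarrow> (real vec \<Rightarrow> real) \<Rightarrow> bool" where
  "convex_fun_on_vec n \<psi> \<longleftrightarrow>
     (\<forall>u \<in> carrier_vec n. \<forall>v \<in> carrier_vec n. \<forall>t. 0 \<le> t \<and> t \<le> 1 \<longrightarrow>
        \<psi> ((1 - t) \<cdot>\<^sub>v u + t \<cdot>\<^sub>v v) \<le> (1 - t) * \<psi> u + t * \<psi> v)"

definition subdifferential :: "nat \<Rightarrow> (real vec \<Rightarrow> real) \<Rightarrow> real vec \<Rightarrow> real vec set" where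
  "subdifferential n \<psi> u =
     {a \<in> carrier_vec n. \<forall>v \<in> carrier_vec n. \<psi> u + a \<bullet> (v - u) \<le> \<psi> v}"

definition l1_norm :: "real vec \<Rightarrow> real" where
  "l1_norm v = (\<Sum>i<dim_vec v. \<bar>v $ i\<bar>)"

definition Omega :: "nat \<Rightarrow> nat \<Rightarrow> real vec set" where
  "Omega s l = {x \<in> carrier_vec s. card {i. i < s \<and> x $ i \<noteq> 0} = l}"

(* Block j occupies the rows offset m j, ..., offset m j + m j - 1 of the stacked matrix, so
   offset m j is the p with index j - 1 when the blocks are numbered from 1, and
   offset m d is the total number of rows. *)
definition offset :: "(nat \<Rightarrow> nat) \<Rightarrow> nat \<Rightarrow> nat" where
  "offset m j = (\<Sum>i<j. m i)"

definition stack_blocks :: "nat \<Rightarrow> nat \<Rightarrow> (nat \<Rightarrow> real mat) \<Rightarrow> real mat" where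
  "stack_blocks n d Bs = mat_of_rows n (concat (map (\<lambda>j. rows (Bs j)) [0..<d]))"

(* Orthogonal in the sense of inverse = transpose; orthogonal_mat of Jordan_Normal_Form
   only asks for pairwise orthogonal nonzero columns. *)
definition orthogonal_square_mat :: "nat \<Rightarrow> real mat \<Rightarrow> bool" where
  "orthogonal_square_mat s Q \<longleftrightarrow>
     Q \<in> carrier_mat s s \<and> transpose_mat Q * Q = 1\<^sub>m s \<and> Q * transpose_mat Q = 1\<^sub>m s"

definition svd_diag :: "nat \<Rightarrow> nat \<Rightarrow> nat \<Rightarrow> (nat \<Rightarrow> real) \<Rightarrow> real mat" where
  "svd_diag p n r \<sigma> = mat p n (\<lambda>(i, j). if i = j \<and> i < r then \<sigma> i else 0)"

definition is_svd ::
  "nat \<Rightarrow> nat \<Rightarrow> nat \<Rightarrow> real mat \<Rightarrow> real mat \<Rightarrow> (nat \<Rightarrow> real) \<Rightarrow> real mat \<Rightarrow> bool" where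
  "is_svd p n r B U \<sigma> V \<longleftrightarrow>
     orthogonal_square_mat p U \<and> orthogonal_square_mat n V \<and>
     (\<forall>i<r. 0 < \<sigma> i) \<and> (\<forall>i j. i \<le> j \<and> j < r \<longrightarrow> \<sigma> j \<le> \<sigma> i) \<and>
     B = U * svd_diag p n r \<sigma> * transpose_mat V"

definition first_cols :: "nat \<Rightarrow> real mat \<Rightarrow> real mat" where
  "first_cols r U = mat (dim_row U) r (\<lambda>(i, j). U $$ (i, j))"

definition U_prime :: "nat \<Rightarrow> nat \<Rightarrow> nat \<Rightarrow> real mat \<Rightarrow> real mat" where
  "U_prime p n r U =
     four_block_mat (transpose_mat (first_cols r U)) (0\<^sub>m r (n - r))
                    (0\<^sub>m (n - r) p)                  (1\<^sub>m (n - r))"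

definition Lambda_prime :: "nat \<Rightarrow> nat \<Rightarrow> (nat \<Rightarrow> real) \<Rightarrow> real mat" where
  "Lambda_prime n r \<sigma> = mat_diag n (\<lambda>i. if i < r then inverse (\<sigma> i) else 1)"

definition B_prime ::
  "nat \<Rightarrow> nat \<Rightarrow> nat \<Rightarrow> real mat \<Rightarrow> (nat \<Rightarrow> real) \<Rightarrow> real mat \<Rightarrow> real mat" where
  "B_prime p n r U \<sigma> V = V * Lambda_prime n r \<sigma> * U_prime p n r U"

lemma length_stacked_rows:
  "length (concat (map (\<lambda>j. rows (Bs j)) [0..<d])) = offset (\<lambda>j. dim_row (Bs j)) d"
  by (induction d) (auto simp: offset_def)

lemma stack_blocks_carrier:
  assumes "\<And>j. j < d \<Longrightarrow> Bs j \<in> carrier_mat (m j) n"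
  shows "stack_blocks n d Bs \<in> carrier_mat (offset m d) n"
proof -
  have "offset (\<lambda>j. dim_row (Bs j)) d = offset m d"
    unfolding offset_def using assms by (intro sum.cong) auto
  then show ?thesis
    unfolding stack_blocks_def by (intro carrier_matI) (simp_all only: mat_of_rows_carrier length_stacked_rows)
qed

lemma offset_less:
  assumes "j < d" "i < m j"
  shows "offset m j + i < offset m d"
proof -
  have "offset m j + i < offset m (Suc j)" using assms by (simp add: offset_def)
  also have "\<dots> \<le> offset m d"
    unfolding offset_def using assms by (intro sum_mono2) auto
  finally show ?thesis .
qed

lemma stack_blocks_index:
  assumes "\<And>j. j < d \<Longrightarrow> Bs j \<in> carrier_mat (m j) n" "j < d" "i < m j" "c < n"
  shows "stack_blocks n d Bs $$ (offset m j + i, c) = Bs j $$ (i, c)"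
  using assms
proof (induction d)
  case (Suc d)
  let ?L = "concat (map (\<lambda>j. rows (Bs j)) [0..<d])"
  have "offset (\<lambda>j. dim_row (Bs j)) d = offset m d"
    unfolding offset_def using Suc.prems(1) by (intro sum.cong refl carrier_matD(1)[where nc = n]) simp
  then have len: "length ?L = offset m d" by (simp only: length_stacked_rows)
  have dim: "dim_row (Bs d) = m d" "dim_col (Bs d) = n" using Suc.prems(1)[of d] by auto
  show ?case
  proof (cases "j < d")
    case True
    then have "offset m j + i < length ?L" using offset_less Suc.prems len by metis
    then show ?thesis using Suc.IH[OF Suc.prems(1) True Suc.prems(3,4)] Suc.prems
      by (simp add: stack_blocks_def mat_of_rows_def nth_append)
  next
    case False
    then have [simp]: "j = d" using Suc.prems by simp
    show ?thesis using Suc.prems len dim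
      by (simp add: stack_blocks_def mat_of_rows_def nth_append)
  qed
qed simp

lemma B_prime_carrier:
  assumes "is_svd p n r B U \<sigma> V" "r \<le> n"
  shows "B_prime p n r U \<sigma> V \<in> carrier_mat n (p + n - r)"
  using assms
  by (auto simp: B_prime_def is_svd_def orthogonal_square_mat_def U_prime_def first_cols_def
      intro!: carrier_matI)

end

theory Submission
  imports Defs
begin

text \<open>
  The objective is \<open>\<psi> x + g (B x)\<close>, where \<open>g y = (\<Sum>q. w\<^sub>q \<bar>y\<^sub>q\<bar>)\<close> and \<open>w\<^sub>q = \<lambda>\<^sub>j\<close> for every row
  \<open>q\<close> of block \<open>j\<close>.  By Fermat's rule and the sum and chain rules of convex analysis, \<open>u\<close> is a
  minimizer iff some \<open>a \<in> \<partial>\<psi>(u)\<close> and \<open>c \<in> \<partial>g(B u)\<close> satisfy \<open>a + B\<^sup>T c = 0\<close>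
  (\<open>weighted_l1_minimizer_iff\<close>).  The nontrivial direction is obtained without a separation
  theorem in \<open>\<real>\<^sup>n\<close>: because \<open>g\<close> is separable, its absolute values can be replaced one after
  another by linear functions while \<open>u\<close> stays a minimizer.  One replacement
  (\<open>minimizer_linearize_abs\<close>) asks for a single slope, that is, for a real number between two
  sets of difference quotients.

  The equation \<open>a = - B\<^sup>T c\<close> can be solved for \<open>c\<close>.  It requires \<open>a\<close> to lie in the range of \<open>B\<^sup>T\<close>,
  which is spanned by the first \<open>r\<close> columns of \<open>V\<close>; the last \<open>n - r\<close> columns of \<open>B'\<close> are the other
  columns of \<open>V\<close>, so this says that they are orthogonal to \<open>a\<close>.  The first \<open>p\<close> columns of \<open>B'\<close> form
  the Moore--Penrose inverse of \<open>B\<close>, and the vector \<open>h\<close> of their products with \<open>a\<close> satisfies \<open>B\<^sup>T h = a\<close> for such \<open>a\<close>.  Hence the solutions are \<open>c = - (h + b)\<close> with \<open>b\<close> in the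
  kernel of \<open>B\<^sup>T\<close> (\<open>eq_uminus_transpose_mult_iff\<close>).

  It remains to read \<open>c \<in> \<partial>g(B u)\<close> entry by entry: where \<open>(B u)\<^sub>q\<close> equals some nonzero
  \<open>z\<^sub>q\<close> it says \<open>\<lambda>\<^sub>j = c\<^sub>q sgn z\<^sub>q\<close>, and where \<open>(B u)\<^sub>q = 0\<close> it says \<open>\<bar>c\<^sub>q\<bar> \<le> \<lambda>\<^sub>j\<close>.
\<close>

section \<open>Fermat's rule for a convex function plus weighted absolute values\<close>

lemma convex_fun_on_vec_add:
  assumes "convex_fun_on_vec n f" "convex_fun_on_vec n g"
  shows "convex_fun_on_vec n (\<lambda>x. f x + g x)"
  unfolding convex_fun_on_vec_def
proof (intro ballI allI impI)
  fix x y :: "real vec" and t :: real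
  assume x: "x \<in> carrier_vec n" and y: "y \<in> carrier_vec n" and t: "0 \<le> t \<and> t \<le> 1"
  have "f ((1 - t) \<cdot>\<^sub>v x + t \<cdot>\<^sub>v y) \<le> (1 - t) * f x + t * f y"
       "g ((1 - t) \<cdot>\<^sub>v x + t \<cdot>\<^sub>v y) \<le> (1 - t) * g x + t * g y"
    using assms x y t unfolding convex_fun_on_vec_def by blast+
  then show "f ((1 - t) \<cdot>\<^sub>v x + t \<cdot>\<^sub>v y) + g ((1 - t) \<cdot>\<^sub>v x + t \<cdot>\<^sub>v y)
      \<le> (1 - t) * (f x + g x) + t * (f y + g y)"
    by (simp add: algebra_simps)
qed

lemma scalar_prod_convex_combination:
  fixes b x y :: "real vec"
  assumes "b \<in> carrier_vec n" "x \<in> carrier_vec n" "y \<in> carrier_vec n"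
  shows "b \<bullet> (s \<cdot>\<^sub>v x + t \<cdot>\<^sub>v y) = s * (b \<bullet> x) + t * (b \<bullet> y)"
  using assms by (simp add: scalar_prod_add_distrib[of _ n])

lemma convex_fun_on_vec_linear:
  assumes "b \<in> carrier_vec n"
  shows "convex_fun_on_vec n (\<lambda>x. c * (b \<bullet> x))"
  using assms by (auto simp: convex_fun_on_vec_def scalar_prod_convex_combination algebra_simps)

lemma convex_fun_on_vec_abs:
  assumes b: "b \<in> carrier_vec n" and w: "0 \<le> w"
  shows "convex_fun_on_vec n (\<lambda>x. w * \<bar>b \<bullet> x\<bar>)"
  unfolding convex_fun_on_vec_def
proof (intro ballI allI impI)
  fix x y :: "real vec" and t :: real
  assume x: "x \<in> carrier_vec n" and y: "y \<in> carrier_vec n" and t: "0 \<le> t \<and> t \<le> 1"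
  have "\<bar>(1 - t) * (b \<bullet> x) + t * (b \<bullet> y)\<bar> \<le> (1 - t) * \<bar>b \<bullet> x\<bar> + t * \<bar>b \<bullet> y\<bar>"
    using abs_triangle_ineq[of "(1 - t) * (b \<bullet> x)" "t * (b \<bullet> y)"] t by (simp add: abs_mult)
  from mult_left_mono[OF this w]
  show "w * \<bar>b \<bullet> ((1 - t) \<cdot>\<^sub>v x + t \<cdot>\<^sub>v y)\<bar> \<le> (1 - t) * (w * \<bar>b \<bullet> x\<bar>) + t * (w * \<bar>b \<bullet> y\<bar>)"
    using b x y by (simp add: scalar_prod_convex_combination algebra_simps)
qed

lemma convex_fun_on_vec_linear_sum:
  fixes k :: nat
  assumes "\<And>q. q < k \<Longrightarrow> b q \<in> carrier_vec n"
  shows "convex_fun_on_vec n (\<lambda>x. \<Sum>q<k. c q * (b q \<bullet> x))"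
  using assms
proof (induction k)
  case 0
  show ?case by (simp add: convex_fun_on_vec_def)
next
  case (Suc k)
  have "convex_fun_on_vec n (\<lambda>x. (\<Sum>q<k. c q * (b q \<bullet> x)) + c k * (b k \<bullet> x))"
    by (rule convex_fun_on_vec_add[OF Suc.IH convex_fun_on_vec_linear]) (simp_all add: Suc.prems)
  then show ?case by simp
qed

text \<open>
  The subdifferential of \<open>\<lambda>\<tau>. w * \<bar>\<tau>\<bar>\<close>, described by the equality case of
  \<open>s * \<tau> \<le> w * \<bar>\<tau>\<bar>\<close>; this form treats zero and nonzero \<open>\<tau>\<close> alike.
\<close>

definition abs_subgradient :: "real \<Rightarrow> real \<Rightarrow> real \<Rightarrow> bool" where
  "abs_subgradient w \<tau> s \<longleftrightarrow> \<bar>s\<bar> \<le> w \<and> s * \<tau> = w * \<bar>\<tau>\<bar>"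

text \<open>
  Testing the subgradient inequality at \<open>2 * \<beta>\<close> and \<open>0\<close> forces the equality \<open>s * \<beta> = w * \<bar>\<beta>\<bar>\<close>, and then its instances at \<open>1\<close> and \<open>- 1\<close> bound \<open>s\<close>.
\<close>

lemma abs_subgradientI:
  assumes "\<And>\<tau>. w * \<bar>\<beta>\<bar> + s * (\<tau> - \<beta>) \<le> w * \<bar>\<tau>\<bar>"
  shows "abs_subgradient w \<beta> s"
proof -
  have "w * \<bar>\<beta>\<bar> + s * (2 * \<beta> - \<beta>) \<le> w * \<bar>2 * \<beta>\<bar>" "w * \<bar>\<beta>\<bar> + s * (0 - \<beta>) \<le> w * \<bar>0\<bar>"
    by (rule assms)+
  then have eq: "s * \<beta> = w * \<bar>\<beta>\<bar>" by (simp add: abs_mult algebra_simps)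
  have "w * \<bar>\<beta>\<bar> + s * (1 - \<beta>) \<le> w * \<bar>1\<bar>" "w * \<bar>\<beta>\<bar> + s * (-1 - \<beta>) \<le> w * \<bar>-1\<bar>"
    by (rule assms)+
  then show ?thesis using eq by (simp add: abs_subgradient_def algebra_simps abs_le_iff)
qed

lemma abs_subgradientD:
  assumes "abs_subgradient w \<beta> s"
  shows "w * \<bar>\<beta>\<bar> + s * (\<tau> - \<beta>) \<le> w * \<bar>\<tau>\<bar>"
proof -
  have "s * \<tau> \<le> \<bar>s\<bar> * \<bar>\<tau>\<bar>" by (metis abs_ge_self abs_mult)
  also have "\<dots> \<le> w * \<bar>\<tau>\<bar>" using assms by (intro mult_right_mono) (auto simp: abs_subgradient_def)
  finally show ?thesis using assms by (simp add: abs_subgradient_def algebra_simps)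
qed

text \<open>
  This is one step of a Hahn--Banach extension.  The function \<open>G x \<tau> = f x + w * \<bar>b \<bullet> x + \<tau>\<bar>\<close> is
  jointly convex, and its minimum over the hyperplane \<open>\<tau> = 0\<close> is \<open>\<mu>\<close>.  The required \<open>s\<close> is the slope of an
  affine minorant \<open>\<mu> + s * \<tau>\<close> of \<open>G\<close>; it exists since by convexity no difference quotient
  towards negative \<open>\<tau>\<close> exceeds one towards positive \<open>\<tau>\<close>.  Fixing \<open>x = u\<close> in
  \<open>\<mu> + s * \<tau> \<le> G x \<tau>\<close> makes \<open>s\<close> a subgradient, while \<open>\<tau> = b \<bullet> u - b \<bullet> x\<close> keeps the argument of the
  absolute value at \<open>b \<bullet> u\<close> and gives the minimality of \<open>u\<close> for the linearized function.
\<close>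

lemma minimizer_linearize_abs:
  assumes f: "convex_fun_on_vec n f" and b: "b \<in> carrier_vec n" and u: "u \<in> carrier_vec n"
    and w: "0 \<le> w"
    and min: "\<And>x. x \<in> carrier_vec n \<Longrightarrow> f u + w * \<bar>b \<bullet> u\<bar> \<le> f x + w * \<bar>b \<bullet> x\<bar>"
  obtains s where "abs_subgradient w (b \<bullet> u) s"
    "\<And>x. x \<in> carrier_vec n \<Longrightarrow> f u + s * (b \<bullet> u) \<le> f x + s * (b \<bullet> x)"
proof -
  define \<mu> where "\<mu> = f u + w * \<bar>b \<bullet> u\<bar>"
  define G where "G x \<tau> = f x + w * \<bar>b \<bullet> x + \<tau>\<bar>" for x \<tau>
  define L where "L = {(\<mu> - G x (- t)) / t | x t. x \<in> carrier_vec n \<and> 0 < t}"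
  (* G x (- t) is used instead of G x t with t < 0 so that both denominators are positive. *)
  have slopes: "(\<mu> - G x (- t)) / t \<le> (G y t' - \<mu>) / t'"
    if x: "x \<in> carrier_vec n" and y: "y \<in> carrier_vec n" and t: "0 < t" and t': "0 < t'"
    for x y and t t' :: real
  proof -
    define c where "c = t / (t + t')"
    have c: "0 \<le> c" "c \<le> 1" "1 - c = t' / (t + t')" using t t' by (auto simp: c_def field_simps)
    have ct: "(1 - c) * t = c * t'" by (simp add: c(3)) (simp add: c_def)
    let ?z = "(1 - c) \<cdot>\<^sub>v x + c \<cdot>\<^sub>v y"
    (* The weights 1 - c and c are chosen so that the two shifts - t and t' cancel. *)
    have bz: "b \<bullet> ?z = (1 - c) * (b \<bullet> x - t) + c * (b \<bullet> y + t')"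
      using b x y ct by (simp add: scalar_prod_convex_combination algebra_simps)
    have "\<bar>b \<bullet> ?z\<bar> \<le> (1 - c) * \<bar>b \<bullet> x - t\<bar> + c * \<bar>b \<bullet> y + t'\<bar>"
      unfolding bz using abs_triangle_ineq[of "(1 - c) * (b \<bullet> x - t)" "c * (b \<bullet> y + t')"] c(1,2)
      by (simp add: abs_mult)
    from mult_left_mono[OF this w]
    have "w * \<bar>b \<bullet> ?z\<bar> \<le> (1 - c) * (w * \<bar>b \<bullet> x - t\<bar>) + c * (w * \<bar>b \<bullet> y + t'\<bar>)"
      by (simp add: algebra_simps)
    moreover have "f ?z \<le> (1 - c) * f x + c * f y"
      using f x y c(1,2) unfolding convex_fun_on_vec_def by blast
    moreover have "\<mu> \<le> f ?z + w * \<bar>b \<bullet> ?z\<bar>"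
      unfolding \<mu>_def using x y by (intro min) auto
    ultimately have "\<mu> \<le> (1 - c) * G x (- t) + c * G y t'"
      by (simp add: G_def algebra_simps)
    then have "(1 - c) * (\<mu> - G x (- t)) \<le> c * (G y t' - \<mu>)"
      by (simp add: algebra_simps)
    then have "t' * (\<mu> - G x (- t)) \<le> t * (G y t' - \<mu>)"
      using t t' unfolding c(3) by (simp add: c_def divide_le_cancel)
    then show ?thesis using t t' by (simp add: field_simps)
  qed
  define s where "s = Sup L"
  have L_mem: "(\<mu> - G x (- t)) / t \<in> L" if "x \<in> carrier_vec n" "0 < t" for x and t :: real
    unfolding L_def using that by blast
  have one: "(0::real) < 1" by simp
  have ne: "L \<noteq> {}" using L_mem[OF u one] by blast
  have L_le: "a \<le> (G y t' - \<mu>) / t'" if "a \<in> L" "y \<in> carrier_vec n" "0 < t'" for a y and t' :: real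
    using that slopes unfolding L_def by blast
  have bdd: "bdd_above L" using L_le[OF _ u one] by (rule bdd_aboveI)
  have key: "\<mu> + s * \<tau> \<le> G x \<tau>" if x: "x \<in> carrier_vec n" for x \<tau>
  proof -
    consider "\<tau> = 0" | "\<tau> > 0" | "\<tau> < 0" by linarith
    then show ?thesis
    proof cases
      case 1
      then show ?thesis using min[OF x] by (simp add: \<mu>_def G_def)
    next
      case 2
      have "s \<le> (G x \<tau> - \<mu>) / \<tau>"
        unfolding s_def using ne L_le[OF _ x 2] by (rule cSup_least)
      then show ?thesis using 2 by (simp add: field_simps)
    next
      case 3
      have "(\<mu> - G x (- (- \<tau>))) / (- \<tau>) \<in> L" using 3 by (intro L_mem x) simp
      then have "(\<mu> - G x (- (- \<tau>))) / (- \<tau>) \<le> s"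
        unfolding s_def using bdd by (rule cSup_upper)
      then show ?thesis using 3 by (simp add: field_simps)
    qed
  qed
  show thesis
  proof
    show "abs_subgradient w (b \<bullet> u) s"
    proof (rule abs_subgradientI)
      fix \<tau>
      show "w * \<bar>b \<bullet> u\<bar> + s * (\<tau> - b \<bullet> u) \<le> w * \<bar>\<tau>\<bar>"
        using key[OF u, of "\<tau> - b \<bullet> u"] by (simp add: \<mu>_def G_def)
    qed
    fix x :: "real vec" assume "x \<in> carrier_vec n"
    from key[OF this, of "b \<bullet> u - b \<bullet> x"]
    show "f u + s * (b \<bullet> u) \<le> f x + s * (b \<bullet> x)"
      by (simp add: \<mu>_def G_def algebra_simps)
  qed
qed

text \<open>
  In the induction step the last absolute value is first absorbed into the convex function, so that the
  induction hypothesis linearizes the earlier ones; the linear terms obtained in this way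
  are then absorbed in turn and the last absolute value is linearized.
\<close>

lemma minimizer_linearize_abs_sum:
  fixes k :: nat
  assumes f: "convex_fun_on_vec n f" and u: "u \<in> carrier_vec n"
    and b: "\<And>q. q < k \<Longrightarrow> b q \<in> carrier_vec n" and w: "\<And>q. q < k \<Longrightarrow> 0 \<le> w q"
    and min: "\<And>x. x \<in> carrier_vec n \<Longrightarrow>
      f u + (\<Sum>q<k. w q * \<bar>b q \<bullet> u\<bar>) \<le> f x + (\<Sum>q<k. w q * \<bar>b q \<bullet> x\<bar>)"
  shows "\<exists>c. (\<forall>q<k. abs_subgradient (w q) (b q \<bullet> u) (c q)) \<and>
    (\<forall>x \<in> carrier_vec n.
      f u + (\<Sum>q<k. c q * (b q \<bullet> u)) \<le> f x + (\<Sum>q<k. c q * (b q \<bullet> x)))"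
  using assms
proof (induction k arbitrary: f)
  case 0
  then show ?case by simp
next
  case (Suc k)
  have bk: "b k \<in> carrier_vec n" and wk: "0 \<le> w k" using Suc.prems by auto
  have "convex_fun_on_vec n (\<lambda>x. f x + w k * \<bar>b k \<bullet> x\<bar>)"
    by (rule convex_fun_on_vec_add[OF Suc.prems(1) convex_fun_on_vec_abs[OF bk wk]])
  then have "\<exists>c. (\<forall>q<k. abs_subgradient (w q) (b q \<bullet> u) (c q)) \<and>
    (\<forall>x \<in> carrier_vec n. f u + w k * \<bar>b k \<bullet> u\<bar> + (\<Sum>q<k. c q * (b q \<bullet> u))
      \<le> f x + w k * \<bar>b k \<bullet> x\<bar> + (\<Sum>q<k. c q * (b q \<bullet> x)))"
  proof (rule Suc.IH[OF _ u])
    fix x :: "real vec" assume "x \<in> carrier_vec n"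
    from Suc.prems(5)[OF this]
    show "f u + w k * \<bar>b k \<bullet> u\<bar> + (\<Sum>q<k. w q * \<bar>b q \<bullet> u\<bar>)
        \<le> f x + w k * \<bar>b k \<bullet> x\<bar> + (\<Sum>q<k. w q * \<bar>b q \<bullet> x\<bar>)"
      by simp
  qed (use Suc.prems in auto)
  then obtain c where c: "\<And>q. q < k \<Longrightarrow> abs_subgradient (w q) (b q \<bullet> u) (c q)"
    and c_min: "\<And>x. x \<in> carrier_vec n \<Longrightarrow>
      f u + w k * \<bar>b k \<bullet> u\<bar> + (\<Sum>q<k. c q * (b q \<bullet> u))
        \<le> f x + w k * \<bar>b k \<bullet> x\<bar> + (\<Sum>q<k. c q * (b q \<bullet> x))"
    by blast
  have conv: "convex_fun_on_vec n (\<lambda>x. f x + (\<Sum>q<k. c q * (b q \<bullet> x)))"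
    by (rule convex_fun_on_vec_add[OF Suc.prems(1) convex_fun_on_vec_linear_sum]) (simp add: Suc.prems)
  have min_k: "f u + (\<Sum>q<k. c q * (b q \<bullet> u)) + w k * \<bar>b k \<bullet> u\<bar>
      \<le> f x + (\<Sum>q<k. c q * (b q \<bullet> x)) + w k * \<bar>b k \<bullet> x\<bar>" if "x \<in> carrier_vec n" for x
    using c_min[OF that] by simp
  obtain s where s: "abs_subgradient (w k) (b k \<bullet> u) s"
    and s_min: "\<And>x. x \<in> carrier_vec n \<Longrightarrow>
      f u + (\<Sum>q<k. c q * (b q \<bullet> u)) + s * (b k \<bullet> u)
        \<le> f x + (\<Sum>q<k. c q * (b q \<bullet> x)) + s * (b k \<bullet> x)"
    using minimizer_linearize_abs[OF conv bk u wk min_k] by blast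
  have old: "(\<Sum>q<k. (c(k := s)) q * (b q \<bullet> x)) = (\<Sum>q<k. c q * (b q \<bullet> x))" for x
    by (intro sum.cong) auto
  show ?case
  proof (intro exI[of _ "c(k := s)"] conjI allI ballI impI)
    fix q assume "q < Suc k"
    then show "abs_subgradient (w q) (b q \<bullet> u) ((c(k := s)) q)"
      using c s by (auto simp: less_Suc_eq)
  next
    fix x :: "real vec" assume "x \<in> carrier_vec n"
    from s_min[OF this]
    show "f u + (\<Sum>q<Suc k. (c(k := s)) q * (b q \<bullet> u))
        \<le> f x + (\<Sum>q<Suc k. (c(k := s)) q * (b q \<bullet> x))"
      unfolding sum.lessThan_Suc old by simp
  qed
qed

lemma sum_mult_row_eq_scalar_prod:
  fixes c :: "real vec"
  assumes "B \<in> carrier_mat p n" "c \<in> carrier_vec p" "x \<in> carrier_vec n"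
  shows "(\<Sum>q<p. c $ q * (row B q \<bullet> x)) = (transpose_mat B *\<^sub>v c) \<bullet> x"
proof -
  have "(\<Sum>q<p. c $ q * (row B q \<bullet> x)) = c \<bullet> (B *\<^sub>v x)"
    unfolding scalar_prod_def using assms by (auto intro!: sum.cong simp: scalar_prod_def)
  also have "\<dots> = (transpose_mat B *\<^sub>v c) \<bullet> x"
    using assms by (simp add: transpose_vec_mult_scalar)
  finally show ?thesis .
qed

text \<open>
  Fermat's rule.  As \<open>\<Sum>q. c\<^sub>q (B x)\<^sub>q = (B\<^sup>T c) \<bullet> x\<close>, minimality of \<open>u\<close> for the linearized
  objective says exactly that \<open>- B\<^sup>T c\<close> is a subgradient of \<open>f\<close> at \<open>u\<close>.  Conversely, adding the
  subgradient inequalities of \<open>f\<close> and of all the absolute values cancels the linear terms.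
\<close>

lemma weighted_l1_minimizer_iff:
  assumes f: "convex_fun_on_vec n f" and u: "u \<in> carrier_vec n" and B: "B \<in> carrier_mat p n"
    and w: "\<And>q. q < p \<Longrightarrow> 0 \<le> w q"
  shows "is_arg_min (\<lambda>x. f x + (\<Sum>q<p. w q * \<bar>(B *\<^sub>v x) $ q\<bar>)) (\<lambda>x. x \<in> carrier_vec n) u \<longleftrightarrow>
    (\<exists>c \<in> carrier_vec p. - (transpose_mat B *\<^sub>v c) \<in> subdifferential n f u \<and>
       (\<forall>q<p. abs_subgradient (w q) ((B *\<^sub>v u) $ q) (c $ q)))"
    (is "?min \<longleftrightarrow> ?dual")
proof -
  have Bq: "(B *\<^sub>v x) $ q = row B q \<bullet> x" if "q < p" for x q using B that by simp
  have rows: "row B q \<in> carrier_vec n" if "q < p" for q using B that by auto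
  have min_iff: "?min \<longleftrightarrow> (\<forall>x \<in> carrier_vec n.
      f u + (\<Sum>q<p. w q * \<bar>row B q \<bullet> u\<bar>) \<le> f x + (\<Sum>q<p. w q * \<bar>row B q \<bullet> x\<bar>))"
    unfolding is_arg_min_def using u by (auto simp: Bq not_less)
  have sub_iff: "- (transpose_mat B *\<^sub>v c) \<in> subdifferential n f u \<longleftrightarrow> (\<forall>x \<in> carrier_vec n.
      f u + (\<Sum>q<p. c $ q * (row B q \<bullet> u)) \<le> f x + (\<Sum>q<p. c $ q * (row B q \<bullet> x)))"
    if c: "c \<in> carrier_vec p" for c
  proof -
    have Bc: "transpose_mat B *\<^sub>v c \<in> carrier_vec n" using B c by auto
    have "- (transpose_mat B *\<^sub>v c) \<bullet> (x - u)
        = (\<Sum>q<p. c $ q * (row B q \<bullet> u)) - (\<Sum>q<p. c $ q * (row B q \<bullet> x))"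
      if x: "x \<in> carrier_vec n" for x
    proof -
      have "- (transpose_mat B *\<^sub>v c) \<bullet> (x - u) = - ((transpose_mat B *\<^sub>v c) \<bullet> (x - u))"
        using carrier_vecD[OF Bc] carrier_vecD[OF u] by (intro scalar_prod_uminus_left) simp
      then show ?thesis
        using x u by (simp add: sum_mult_row_eq_scalar_prod[OF B c] scalar_prod_minus_distrib[OF Bc x u])
    qed
    then show ?thesis using Bc unfolding subdifferential_def
      by (force simp: algebra_simps)
  qed
  show ?thesis
  proof
    assume ?min
    then obtain c where
      c: "\<forall>q<p. abs_subgradient (w q) (row B q \<bullet> u) (c q)" and
      c_min: "\<forall>x \<in> carrier_vec n. f u + (\<Sum>q<p. c q * (row B q \<bullet> u)) \<le> f x + (\<Sum>q<p. c q * (row B q \<bullet> x))"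
      using minimizer_linearize_abs_sum[of n f u p "row B" w] f u rows w min_iff by blast
    show ?dual
    proof (intro bexI[of _ "vec p c"] conjI)
      show "- (transpose_mat B *\<^sub>v vec p c) \<in> subdifferential n f u"
        using c_min by (subst sub_iff) auto
      show "\<forall>q<p. abs_subgradient (w q) ((B *\<^sub>v u) $ q) (vec p c $ q)"
        using c by (simp add: Bq)
    qed auto
  next
    assume ?dual
    then obtain c where c: "c \<in> carrier_vec p" "- (transpose_mat B *\<^sub>v c) \<in> subdifferential n f u"
      and sub: "\<And>q. q < p \<Longrightarrow> abs_subgradient (w q) (row B q \<bullet> u) (c $ q)"
      by (auto simp: Bq)
    show ?min
      unfolding min_iff
    proof
      fix x :: "real vec" assume x: "x \<in> carrier_vec n"
      have "(\<Sum>q<p. w q * \<bar>row B q \<bullet> u\<bar> + c $ q * (row B q \<bullet> x - row B q \<bullet> u))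
          \<le> (\<Sum>q<p. w q * \<bar>row B q \<bullet> x\<bar>)"
        by (intro sum_mono abs_subgradientD sub) auto
      moreover have "f u + (\<Sum>q<p. c $ q * (row B q \<bullet> u)) \<le> f x + (\<Sum>q<p. c $ q * (row B q \<bullet> x))"
        using c x sub_iff by blast
      ultimately show "f u + (\<Sum>q<p. w q * \<bar>row B q \<bullet> u\<bar>) \<le> f x + (\<Sum>q<p. w q * \<bar>row B q \<bullet> x\<bar>)"
        by (simp add: sum.distrib sum_subtractf algebra_simps)
    qed
  qed
qed

section \<open>Solving for the dual variable through the singular value decomposition\<close>

text \<open>
  The product \<open>B'\<^sup>T a\<close> in the coordinates \<open>y = V\<^sup>T a\<close>: its upper part expands \<open>y\<^sub>i / \<sigma>\<^sub>i\<close>, \<open>i < r\<close>, in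
  the columns of \<open>U\<close>, and its lower part is the part of \<open>y\<close> that belongs to the kernel of \<open>B\<close>.
\<close>

lemma B_prime_col_scalar_prod:
  fixes a :: "real vec"
  assumes svd: "is_svd p n r B U \<sigma> V" and r: "r \<le> n" "r \<le> p" and a: "a \<in> carrier_vec n"
  shows "q < p \<Longrightarrow> col (B_prime p n r U \<sigma> V) q \<bullet> a
      = (U *\<^sub>v vec p (\<lambda>i. if i < r then (transpose_mat V *\<^sub>v a) $ i / \<sigma> i else 0)) $ q"
    and "t < n - r \<Longrightarrow> col (B_prime p n r U \<sigma> V) (p + t) \<bullet> a = (transpose_mat V *\<^sub>v a) $ (r + t)"
proof -
  let ?y = "transpose_mat V *\<^sub>v a"
  have U: "U \<in> carrier_mat p p" and V: "V \<in> carrier_mat n n"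
    using svd by (auto simp: is_svd_def orthogonal_square_mat_def)
  have U': "U_prime p n r U \<in> carrier_mat n (p + (n - r))"
    using U r by (auto simp: U_prime_def first_cols_def)
  have U'_left: "U_prime p n r U $$ (i, q) = (if i < r then U $$ (q, i) else 0)"
    if "i < n" "q < p" for i q
    using U r that by (simp add: U_prime_def first_cols_def)
  have U'_right: "U_prime p n r U $$ (i, p + t) = (if i = r + t then 1 else 0)"
    if "i < n" "t < n - r" for i t
    using U r that by (auto simp: U_prime_def first_cols_def)
  have col: "col (B_prime p n r U \<sigma> V) q \<bullet> a
      = (\<Sum>i<n. (if i < r then inverse (\<sigma> i) else 1) * U_prime p n r U $$ (i, q) * ?y $ i)"
    if q: "q < p + (n - r)" for q
  proof -
    let ?M = "mat n (p + (n - r)) (\<lambda>(i, j). (if i < r then inverse (\<sigma> i) else 1) * U_prime p n r U $$ (i, j))"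
    have M: "col ?M q \<in> carrier_vec n" using col_dim[of ?M q] by (simp only: dim_row_mat)
    have "B_prime p n r U \<sigma> V = V * (Lambda_prime n r \<sigma> * U_prime p n r U)"
      unfolding B_prime_def using U' V
      by (intro assoc_mult_mat[of _ n n _ n _ "p + (n - r)"]) (auto simp: Lambda_prime_def)
    also have "Lambda_prime n r \<sigma> * U_prime p n r U = ?M"
      unfolding Lambda_prime_def by (rule mat_diag_mult_left[OF U'])
    finally have "col (B_prime p n r U \<sigma> V) q = V *\<^sub>v col ?M q"
      using col_mult2[OF V mat_carrier q] by (simp only:)
    then have "col (B_prime p n r U \<sigma> V) q \<bullet> a = (V *\<^sub>v col ?M q) \<bullet> a"
      by (simp only:)
    also have "\<dots> = a \<bullet> (V *\<^sub>v col ?M q)"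
      by (rule comm_scalar_prod[OF mult_mat_vec_carrier[OF V M] a])
    also have "\<dots> = ?y \<bullet> col ?M q"
      by (rule transpose_vec_mult_scalar[OF V M a, symmetric])
    also have "\<dots> = (\<Sum>i<n. ?y $ i * col ?M q $ i)"
      by (simp add: scalar_prod_def atLeast0LessThan)
    also have "\<dots> = (\<Sum>i<n. (if i < r then inverse (\<sigma> i) else 1) * U_prime p n r U $$ (i, q) * ?y $ i)"
      using q by (intro sum.cong) auto
    finally show ?thesis .
  qed
  show "col (B_prime p n r U \<sigma> V) q \<bullet> a
      = (U *\<^sub>v vec p (\<lambda>i. if i < r then ?y $ i / \<sigma> i else 0)) $ q" if q: "q < p"
  proof -
    have "col (B_prime p n r U \<sigma> V) q \<bullet> a
      = (\<Sum>i<n. (if i < r then inverse (\<sigma> i) else 1) * U_prime p n r U $$ (i, q) * ?y $ i)"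
      using q by (intro col) auto
    also have "\<dots> = (\<Sum>i<n. if i < r then U $$ (q, i) * (?y $ i / \<sigma> i) else 0)"
      by (intro sum.cong refl) (simp add: U'_left q divide_inverse)
    also have "\<dots> = (\<Sum>i<r. U $$ (q, i) * (?y $ i / \<sigma> i))"
      using r by (intro sum.mono_neutral_cong_right) auto
    also have "\<dots> = (\<Sum>i<p. U $$ (q, i) * (if i < r then ?y $ i / \<sigma> i else 0))"
      using r by (intro sum.mono_neutral_cong_left) auto
    also have "\<dots> = (U *\<^sub>v vec p (\<lambda>i. if i < r then ?y $ i / \<sigma> i else 0)) $ q"
      using U q by (auto simp: scalar_prod_def atLeast0LessThan intro!: sum.cong)
    finally show ?thesis .
  qed
  show "col (B_prime p n r U \<sigma> V) (p + t) \<bullet> a = ?y $ (r + t)" if t: "t < n - r"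
  proof -
    have "col (B_prime p n r U \<sigma> V) (p + t) \<bullet> a
      = (\<Sum>i<n. (if i < r then inverse (\<sigma> i) else 1) * U_prime p n r U $$ (i, p + t) * ?y $ i)"
      using t by (intro col) auto
    also have "\<dots> = (\<Sum>i<n. if i = r + t then ?y $ i else 0)"
      by (intro sum.cong refl) (simp add: U'_right t)
    also have "\<dots> = ?y $ (r + t)" using t by simp
    finally show ?thesis .
  qed
qed

lemma mult_mat_vec_uminus:
  fixes A :: "real mat"
  assumes "A \<in> carrier_mat nr nc" "v \<in> carrier_vec nc"
  shows "A *\<^sub>v (- v) = - (A *\<^sub>v v)"
  using assms by (intro eq_vecI) (auto simp: scalar_prod_def sum_negf)

text \<open>
  Write \<open>y = V\<^sup>T a\<close> and \<open>B\<^sup>T = V D\<^sup>T U\<^sup>T\<close>.  Every vector \<open>D\<^sup>T v\<close> vanishes from entry \<open>r\<close> on, so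
  \<open>a = - B\<^sup>T c\<close> forces the tail of \<open>y\<close>, hence the products of \<open>a\<close> with the last columns of \<open>B'\<close>, to be zero.
  When this tail is zero, the vector \<open>h\<close> of the first \<open>p\<close> products has \<open>B\<^sup>T h = a\<close>, and
  \<open>a = - B\<^sup>T c\<close> turns into \<open>B\<^sup>T (c + h) = 0\<close>.
\<close>

lemma eq_uminus_transpose_mult_iff:
  fixes a c :: "real vec"
  assumes svd: "is_svd p n r B U \<sigma> V" and r: "r \<le> n" "r \<le> p"
    and a: "a \<in> carrier_vec n" and c: "c \<in> carrier_vec p"
  defines "B' \<equiv> B_prime p n r U \<sigma> V"
  shows "a = - (transpose_mat B *\<^sub>v c) \<longleftrightarrow>
    (\<forall>i \<in> {..<p + n - r} - {..<p}. col B' i \<bullet> a = 0) \<and>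
    - (c + vec p (\<lambda>q. col B' q \<bullet> a)) \<in> mat_kernel (transpose_mat B)"
proof -
  let ?y = "transpose_mat V *\<^sub>v a" and ?D = "svd_diag p n r \<sigma>"
  define s where "s = vec p (\<lambda>i. if i < r then ?y $ i / \<sigma> i else 0)"
  define h where "h = vec p (\<lambda>q. col B' q \<bullet> a)"
  have U: "U \<in> carrier_mat p p" "transpose_mat U * U = 1\<^sub>m p"
    and V: "V \<in> carrier_mat n n" "V * transpose_mat V = 1\<^sub>m n" "transpose_mat V * V = 1\<^sub>m n"
    and \<sigma>: "\<And>i. i < r \<Longrightarrow> 0 < \<sigma> i" and B_eq: "B = U * ?D * transpose_mat V"
    using svd by (auto simp: is_svd_def orthogonal_square_mat_def)
  have D: "?D \<in> carrier_mat p n" by (simp add: svd_diag_def)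
  have B: "B \<in> carrier_mat p n" and BT: "transpose_mat B \<in> carrier_mat n p"
    using B_eq U V D by auto
  have y: "?y \<in> carrier_vec n" and s: "s \<in> carrier_vec p" and h: "h \<in> carrier_vec p"
    using V a by (auto simp: s_def h_def)
  have Vy: "V *\<^sub>v ?y = a" using V a by (simp flip: assoc_mult_mat_vec)
  have BTv: "transpose_mat B *\<^sub>v v = V *\<^sub>v (transpose_mat ?D *\<^sub>v (transpose_mat U *\<^sub>v v))"
    if v: "v \<in> carrier_vec p" for v
  proof -
    have "transpose_mat B = V * (transpose_mat ?D * transpose_mat U)"
      unfolding B_eq using U V D by (simp add: transpose_mult[of _ p n _ n] transpose_mult[of _ p p _ n])
    then show ?thesis using U V D v
      by (simp add: assoc_mult_mat_vec[of _ n n _ p] assoc_mult_mat_vec[of _ n p _ p])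
  qed
  have DT: "(transpose_mat ?D *\<^sub>v v) $ i = (if i < r then \<sigma> i * v $ i else 0)"
    if v: "v \<in> carrier_vec p" and i: "i < n" for v i
  proof -
    have "(transpose_mat ?D *\<^sub>v v) $ i = (\<Sum>j<p. ?D $$ (j, i) * v $ j)"
      using v i D by (auto simp: scalar_prod_def atLeast0LessThan intro!: sum.cong)
    also have "\<dots> = (\<Sum>j<p. if j = i then (if i < r then \<sigma> i * v $ i else 0) else 0)"
      using i by (intro sum.cong) (auto simp: svd_diag_def)
    also have "\<dots> = (if i < r then \<sigma> i * v $ i else 0)" using r by auto
    finally show ?thesis .
  qed
  have h_eq: "h = U *\<^sub>v s"
    using U by (intro eq_vecI) (simp_all add: h_def B'_def s_def B_prime_col_scalar_prod(1)[OF svd r a])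
  define tail where "tail \<longleftrightarrow> (\<forall>i. r \<le> i \<and> i < n \<longrightarrow> ?y $ i = 0)"
  have tail_iff: "(\<forall>i \<in> {..<p + n - r} - {..<p}. col B' i \<bullet> a = 0) \<longleftrightarrow> tail"
  proof -
    have "(\<forall>i \<in> {..<p + n - r} - {..<p}. col B' i \<bullet> a = 0) \<longleftrightarrow> (\<forall>t<n - r. col B' (p + t) \<bullet> a = 0)"
    proof (intro iffI allI ballI impI)
      fix i assume "\<forall>t<n - r. col B' (p + t) \<bullet> a = 0" "i \<in> {..<p + n - r} - {..<p}"
      then have "i - p < n - r" "p + (i - p) = i" using r by auto
      then show "col B' i \<bullet> a = 0"
        using \<open>\<forall>t<n - r. col B' (p + t) \<bullet> a = 0\<close> by metis
    qed (use r in auto)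
    also have "\<dots> \<longleftrightarrow> (\<forall>t<n - r. ?y $ (r + t) = 0)"
      by (simp add: B'_def B_prime_col_scalar_prod(2)[OF svd r a])
    also have "\<dots> \<longleftrightarrow> tail"
      unfolding tail_def
    proof (intro iffI allI impI)
      fix i assume *: "\<forall>t<n - r. ?y $ (r + t) = 0" "r \<le> i \<and> i < n"
      then have "i - r < n - r" "r + (i - r) = i" by auto
      then show "?y $ i = 0" using *(1) by metis
    qed auto
    finally show ?thesis .
  qed
  have BTh: "transpose_mat B *\<^sub>v h = a" if tail
  proof -
    have "transpose_mat U *\<^sub>v h = s"
      unfolding h_eq using U s by (simp flip: assoc_mult_mat_vec)
    moreover have "transpose_mat ?D *\<^sub>v s = ?y"
    proof (rule eq_vecI)
      fix i assume "i < dim_vec ?y"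
      then have i: "i < n" by (simp only: carrier_vecD[OF y])
      show "(transpose_mat ?D *\<^sub>v s) $ i = ?y $ i"
        unfolding DT[OF s i] using \<sigma>[of i] \<open>tail\<close> i r by (auto simp: s_def tail_def)
    qed (use V D in auto)
    ultimately show ?thesis using BTv[OF h] Vy by simp
  qed
  have BTc: "transpose_mat B *\<^sub>v c \<in> carrier_vec n" using BT c by auto
  have ker: "- (c + h) \<in> mat_kernel (transpose_mat B) \<longleftrightarrow> transpose_mat B *\<^sub>v c = - a"
    if tail
  proof -
    have "transpose_mat B *\<^sub>v (- (c + h)) = - (transpose_mat B *\<^sub>v c + a)"
      unfolding mult_mat_vec_uminus[OF BT add_carrier_vec[OF c h]]
        mult_add_distrib_mat_vec[OF BT c h] BTh[OF that] ..
    then have "- (c + h) \<in> mat_kernel (transpose_mat B) \<longleftrightarrow> - (transpose_mat B *\<^sub>v c + a) = 0\<^sub>v n"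
      using c h by (auto simp: mat_kernel[OF BT])
    also have "\<dots> \<longleftrightarrow> transpose_mat B *\<^sub>v c = - a"
      using B BTc a by (auto simp: vec_eq_iff eq_neg_iff_add_eq_0)
    finally show ?thesis .
  qed
  have tailI: tail if "a = - (transpose_mat B *\<^sub>v c)"
  proof -
    let ?v = "transpose_mat U *\<^sub>v c"
    have v: "?v \<in> carrier_vec p" using U c by auto
    have w: "transpose_mat ?D *\<^sub>v ?v \<in> carrier_vec n" using D v by auto
    have "transpose_mat V *\<^sub>v (V *\<^sub>v (transpose_mat ?D *\<^sub>v ?v)) = transpose_mat ?D *\<^sub>v ?v"
      unfolding assoc_mult_mat_vec[OF transpose_carrier_mat[THEN iffD2, OF V(1)] V(1) w, symmetric] V(3)
      by (rule one_mult_mat_vec[OF w])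
    moreover have "?y = - (transpose_mat V *\<^sub>v (V *\<^sub>v (transpose_mat ?D *\<^sub>v ?v)))"
      unfolding that BTv[OF c]
      by (rule mult_mat_vec_uminus[OF transpose_carrier_mat[THEN iffD2, OF V(1)] mult_mat_vec_carrier[OF V(1) w]])
    ultimately have "?y = - (transpose_mat ?D *\<^sub>v ?v)" by simp
    moreover have "(- (transpose_mat ?D *\<^sub>v ?v)) $ i = 0" if "r \<le> i" "i < n" for i
      using DT[OF v that(2)] that w by (subst index_uminus_vec(1)) (simp_all only: carrier_vecD[OF w], simp)
    ultimately show tail unfolding tail_def by simp
  qed
  have "a = - (transpose_mat B *\<^sub>v c) \<longleftrightarrow> transpose_mat B *\<^sub>v c = - a"
    using B BTc a by (auto simp: vec_eq_iff)
  then show ?thesis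
    unfolding tail_iff h_def[symmetric] using tailI ker by (cases tail) blast+
qed

section \<open>Blocks of the stacked matrix\<close>

lemma sum_lessThan_add:
  fixes h :: "nat \<Rightarrow> real" and a b :: nat
  shows "(\<Sum>q<a + b. h q) = (\<Sum>q<a. h q) + (\<Sum>i<b. h (a + i))"
  by (induction b) auto

lemma sum_offset:
  "(\<Sum>q<offset m d. h q) = (\<Sum>j<d. \<Sum>i<m j. (h (offset m j + i) :: real))"
proof (induction d)
  case (Suc d)
  have "(\<Sum>q<offset m d + m d. h q) = (\<Sum>q<offset m d. h q) + (\<Sum>i<m d. h (offset m d + i))"
    by (rule sum_lessThan_add)
  then show ?case using Suc by (simp add: offset_def)
qed (simp add: offset_def)

lemma all_less_offset_iff:
  "(\<forall>q<offset m d. P q) \<longleftrightarrow> (\<forall>j<d. \<forall>i<m j. P (offset m j + i))"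
proof (induction d)
  case (Suc d)
  have "(\<forall>q<offset m d + m d. P q) \<longleftrightarrow> (\<forall>q<offset m d. P q) \<and> (\<forall>i<m d. P (offset m d + i))"
  proof (intro iffI conjI allI impI)
    fix q assume *: "(\<forall>q<offset m d. P q) \<and> (\<forall>i<m d. P (offset m d + i))" "q < offset m d + m d"
    show "P q"
    proof (cases "q < offset m d")
      case False
      then have "q = offset m d + (q - offset m d)" "q - offset m d < m d" using *(2) by auto
      then show ?thesis using *(1) by metis
    qed (use * in auto)
  qed auto
  then show ?case using Suc by (auto simp: offset_def less_Suc_eq)
qed (simp add: offset_def)

text \<open>
  Turns the block weights into one weight per row of the stacked matrix: a row of block \<open>j\<close>
  has index below \<open>offset m (Suc j)\<close>, and \<open>j\<close> is least with this property.
\<close>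

definition block_of :: "(nat \<Rightarrow> nat) \<Rightarrow> nat \<Rightarrow> nat" where
  "block_of m q = (LEAST j. q < offset m (Suc j))"

lemma block_of_offset_add:
  assumes "i < m j"
  shows "block_of m (offset m j + i) = j"
  unfolding block_of_def
proof (rule Least_equality)
  show "offset m j + i < offset m (Suc j)" using assms by (simp add: offset_def)
  fix j' assume less: "offset m j + i < offset m (Suc j')"
  show "j \<le> j'"
  proof (rule ccontr)
    assume "\<not> j \<le> j'"
    then have "offset m (Suc j') \<le> offset m j" unfolding offset_def by (intro sum_mono2) auto
    then show False using less by simp
  qed
qed

lemma stack_blocks_mult_vec_index:
  assumes "\<And>j. j < d \<Longrightarrow> Bs j \<in> carrier_mat (m j) n" "j < d" "i < m j" "x \<in> carrier_vec n"
  shows "(stack_blocks n d Bs *\<^sub>v x) $ (offset m j + i) = (Bs j *\<^sub>v x) $ i"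
proof -
  have "row (stack_blocks n d Bs) (offset m j + i) = row (Bs j) i"
    using assms(1)[OF assms(2)] stack_blocks_carrier[of d Bs m n, OF assms(1)]
      offset_less[of j d i m, OF assms(2,3)] stack_blocks_index[of d Bs m n j i, OF assms(1-3)] assms(3)
    by (intro eq_vecI) auto
  then show ?thesis
    using assms(1)[OF assms(2)] stack_blocks_carrier[of d Bs m n, OF assms(1)]
      offset_less[of j d i m, OF assms(2,3)] assms(3)
    by simp
qed

lemma unit_vec_sum_index:
  fixes k :: "nat \<Rightarrow> nat" and x :: "nat \<Rightarrow> real"
  assumes k: "inj_on k {..<l}" and i: "i < s"
  shows "finsum_vec TYPE(real) s (\<lambda>i. x (k i) \<cdot>\<^sub>v unit_vec s (k i)) {..<l} $ i
    = (if i \<in> k ` {..<l} then x i else 0)"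
proof -
  have "finsum_vec TYPE(real) s (\<lambda>i. x (k i) \<cdot>\<^sub>v unit_vec s (k i)) {..<l} $ i
      = (\<Sum>h<l. if k h = i then x (k h) else 0)"
    using i by (subst index_finsum_vec) (auto intro!: sum.cong simp: unit_vec_def)
  also have "\<dots> = (\<Sum>h\<in>k ` {..<l}. if h = i then x h else 0)"
    by (subst sum.reindex[OF k]) simp
  also have "\<dots> = (if i \<in> k ` {..<l} then x i else 0)" by simp
  finally show ?thesis .
qed

lemma abs_subgradient_nonzero_iff:
  assumes "\<tau> \<noteq> 0" "0 < w"
  shows "abs_subgradient w \<tau> s \<longleftrightarrow> w = s * sgn \<tau>"
proof (cases "0 < \<tau>")
  case True
  then show ?thesis using assms(2) by (auto simp: abs_subgradient_def)
next
  case False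
  then have "\<tau> < 0" using assms(1) by simp
  then have "s * \<tau> = w * \<bar>\<tau>\<bar> \<longleftrightarrow> s * \<tau> = (- w) * \<tau>" by simp
  also have "\<dots> \<longleftrightarrow> s = - w" using assms(1) by (simp only: mult_cancel_right) simp
  finally show ?thesis using \<open>\<tau> < 0\<close> assms(2) by (auto simp: abs_subgradient_def)
qed

lemma abs_subgradient_zero_iff: "abs_subgradient w 0 s \<longleftrightarrow> \<bar>s\<bar> \<le> w"
  by (simp add: abs_subgradient_def)

theorem theorem1:
  fixes n d r :: nat
    and m l :: "nat \<Rightarrow> nat"
    and k :: "nat \<Rightarrow> nat \<Rightarrow> nat"
    and \<psi> :: "real vec \<Rightarrow> real"
    and Bs :: "nat \<Rightarrow> real mat"
    and B B' U V :: "real mat"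
    and \<sigma> lam :: "nat \<Rightarrow> real"
    and u z :: "real vec"
  assumes n_pos: "0 < n"
    and d_pos: "0 < d"
    and m_pos: "\<And>j. j < d \<Longrightarrow> 0 < m j"
    and \<psi>_nonneg: "\<And>x. x \<in> carrier_vec n \<Longrightarrow> 0 \<le> \<psi> x"
    and \<psi>_convex: "convex_fun_on_vec n \<psi>"
    and Bs_carrier: "\<And>j. j < d \<Longrightarrow> Bs j \<in> carrier_mat (m j) n"
    and B_eq: "B = stack_blocks n d Bs"
    and r_eq: "r = vec_space.rank (offset m d) B"
    and r_pos: "0 < r"
    and r_le: "r \<le> min (offset m d) n"
    and svd: "is_svd (offset m d) n r B U \<sigma> V"
    and B'_eq: "B' = B_prime (offset m d) n r U \<sigma> V"
    and lam_pos: "\<And>j. j < d \<Longrightarrow> 0 < lam j"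
    and u_carrier: "u \<in> carrier_vec n"
    and z_carrier: "z \<in> carrier_vec (offset m d)"
    and l_le: "\<And>j. j < d \<Longrightarrow> l j \<le> m j"
    and k_mono: "\<And>j. j < d \<Longrightarrow> strict_mono_on {..<l j} (k j)"
    and k_less: "\<And>j i. j < d \<Longrightarrow> i < l j \<Longrightarrow> k j i < m j"
    and z_nonzero: "\<And>j i. j < d \<Longrightarrow> i < l j \<Longrightarrow> z $ (offset m j + k j i) \<noteq> 0"
    and Bu_eq: "\<And>j. j < d \<Longrightarrow> Bs j *\<^sub>v u =
        finsum_vec TYPE(real) (m j)
          (\<lambda>i. z $ (offset m j + k j i) \<cdot>\<^sub>v unit_vec (m j) (k j i)) {..<l j}"
    and Bu_sparse: "\<And>j. j < d \<Longrightarrow> Bs j *\<^sub>v u \<in> Omega (m j) (l j)"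
  shows "is_arg_min (\<lambda>x. \<psi> x + (\<Sum>j<d. lam j * l1_norm (Bs j *\<^sub>v x)))
           (\<lambda>x. x \<in> carrier_vec n) u
    \<longleftrightarrow>
    (\<exists>a \<in> subdifferential n \<psi> u. \<exists>b \<in> mat_kernel (transpose_mat B).
       (\<forall>i \<in> {..<offset m d + n - r} - {..<offset m d}. col B' i \<bullet> a = 0) \<and>
       (\<forall>j<d.
          (\<forall>i<l j. lam j =
             - (col B' (offset m j + k j i) \<bullet> a + b $ (offset m j + k j i))
               * sgn (z $ (offset m j + k j i))) \<and>
          (\<forall>i \<in> {..<m j} - k j ` {..<l j}. lam j \<ge>
             \<bar>col B' (offset m j + i) \<bullet> a + b $ (offset m j + i)\<bar>)))"
proof -
  define p where "p = offset m d"
  define w where "w q = lam (block_of m q)" for q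
  have B: "B \<in> carrier_mat p n"
    unfolding B_eq p_def by (rule stack_blocks_carrier) (rule Bs_carrier)
  have BT: "transpose_mat B \<in> carrier_mat n p" using B by simp
  have r: "r \<le> n" "r \<le> p" using r_le by (auto simp: p_def)
  have svd': "is_svd p n r B U \<sigma> V" using svd by (simp add: p_def)
  have block: "(B *\<^sub>v x) $ (offset m j + i) = (Bs j *\<^sub>v x) $ i" "w (offset m j + i) = lam j"
    if "j < d" "i < m j" "x \<in> carrier_vec n" for j i x
    unfolding B_eq w_def using that
    by (simp_all add: stack_blocks_mult_vec_index[of d Bs m n, OF Bs_carrier] block_of_offset_add)
  have w: "0 \<le> w q" if "q < p" for q
  proof -
    have "\<forall>q<offset m d. 0 \<le> w q"
      unfolding all_less_offset_iff using lam_pos by (auto simp: w_def block_of_offset_add less_imp_le)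
    then show ?thesis using that by (simp add: p_def)
  qed
  have objective: "(\<Sum>j<d. lam j * l1_norm (Bs j *\<^sub>v x)) = (\<Sum>q<p. w q * \<bar>(B *\<^sub>v x) $ q\<bar>)"
    if x: "x \<in> carrier_vec n" for x
  proof -
    have "lam j * l1_norm (Bs j *\<^sub>v x) = (\<Sum>i<m j. w (offset m j + i) * \<bar>(B *\<^sub>v x) $ (offset m j + i)\<bar>)"
      if j: "j < d" for j
      using Bs_carrier[OF j] block[OF j _ x] by (simp add: l1_norm_def sum_distrib_left)
    then show ?thesis unfolding p_def sum_offset by simp
  qed
  have Bu: "(Bs j *\<^sub>v u) $ i = (if i \<in> k j ` {..<l j} then z $ (offset m j + i) else 0)"
    if j: "j < d" and i: "i < m j" for j i
    unfolding Bu_eq[OF j]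
    using unit_vec_sum_index[OF strict_mono_on_imp_inj_on[OF k_mono[OF j]] i,
        of "\<lambda>i. z $ (offset m j + i)"] .
  (* Used with c q = - (col B' q \<bullet> a + b $ q): the rows k j i are those where B u is
     nonzero, so there the subgradient is determined by the sign of z. *)
  have signs: "(\<forall>q<p. abs_subgradient (w q) ((B *\<^sub>v u) $ q) (c q)) \<longleftrightarrow>
      (\<forall>j<d. (\<forall>i<l j. lam j = c (offset m j + k j i) * sgn (z $ (offset m j + k j i))) \<and>
        (\<forall>i \<in> {..<m j} - k j ` {..<l j}. lam j \<ge> \<bar>c (offset m j + i)\<bar>))" for c :: "nat \<Rightarrow> real"
  proof -
    have "(\<forall>i<m j. abs_subgradient (w (offset m j + i)) ((B *\<^sub>v u) $ (offset m j + i)) (c (offset m j + i)))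
      \<longleftrightarrow> (\<forall>i<l j. lam j = c (offset m j + k j i) * sgn (z $ (offset m j + k j i))) \<and>
        (\<forall>i \<in> {..<m j} - k j ` {..<l j}. lam j \<ge> \<bar>c (offset m j + i)\<bar>)" (is "?l \<longleftrightarrow> ?r")
      if j: "j < d" for j
    proof -
      let ?S = "\<lambda>i. abs_subgradient (lam j) (if i \<in> k j ` {..<l j} then z $ (offset m j + i) else 0)
        (c (offset m j + i))"
      have "?l \<longleftrightarrow> (\<forall>i<m j. ?S i)"
        using block[OF j _ u_carrier] Bu[OF j] by simp
      also have "\<dots> \<longleftrightarrow> (\<forall>i \<in> k j ` {..<l j}. ?S i) \<and> (\<forall>i \<in> {..<m j} - k j ` {..<l j}. ?S i)"
        using k_less[OF j] by auto
      also have "(\<forall>i \<in> k j ` {..<l j}. ?S i) \<longleftrightarrow>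
          (\<forall>i<l j. lam j = c (offset m j + k j i) * sgn (z $ (offset m j + k j i)))"
        using abs_subgradient_nonzero_iff[OF z_nonzero[OF j] lam_pos[OF j]] by auto
      also have "(\<forall>i \<in> {..<m j} - k j ` {..<l j}. ?S i) \<longleftrightarrow>
          (\<forall>i \<in> {..<m j} - k j ` {..<l j}. lam j \<ge> \<bar>c (offset m j + i)\<bar>)"
        by (intro ball_cong refl) (simp add: abs_subgradient_zero_iff)
      finally show ?thesis .
    qed
    then show ?thesis unfolding p_def all_less_offset_iff by blast
  qed
  have "is_arg_min (\<lambda>x. \<psi> x + (\<Sum>j<d. lam j * l1_norm (Bs j *\<^sub>v x))) (\<lambda>x. x \<in> carrier_vec n) u
      \<longleftrightarrow> is_arg_min (\<lambda>x. \<psi> x + (\<Sum>q<p. w q * \<bar>(B *\<^sub>v x) $ q\<bar>)) (\<lambda>x. x \<in> carrier_vec n) u"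
    using u_carrier by (auto simp: is_arg_min_def objective)
  also have "\<dots> \<longleftrightarrow> (\<exists>c \<in> carrier_vec p. - (transpose_mat B *\<^sub>v c) \<in> subdifferential n \<psi> u \<and>
       (\<forall>q<p. abs_subgradient (w q) ((B *\<^sub>v u) $ q) (c $ q)))"
    by (rule weighted_l1_minimizer_iff[OF \<psi>_convex u_carrier B w])
  also have "\<dots> \<longleftrightarrow> (\<exists>a \<in> subdifferential n \<psi> u. \<exists>b \<in> mat_kernel (transpose_mat B).
       (\<forall>i \<in> {..<p + n - r} - {..<p}. col B' i \<bullet> a = 0) \<and>
       (\<forall>q<p. abs_subgradient (w q) ((B *\<^sub>v u) $ q) (- (col B' q \<bullet> a + b $ q))))"
    (is "?L \<longleftrightarrow> ?R")
  proof
    assume ?L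
    then obtain c where c: "c \<in> carrier_vec p" "- (transpose_mat B *\<^sub>v c) \<in> subdifferential n \<psi> u"
      "\<forall>q<p. abs_subgradient (w q) ((B *\<^sub>v u) $ q) (c $ q)" by blast
    let ?a = "- (transpose_mat B *\<^sub>v c)"
    let ?b = "- (c + vec p (\<lambda>q. col B' q \<bullet> ?a))"
    have a: "?a \<in> carrier_vec n" using BT c by auto
    have "(\<forall>i \<in> {..<p + n - r} - {..<p}. col B' i \<bullet> ?a = 0) \<and> ?b \<in> mat_kernel (transpose_mat B)"
      using eq_uminus_transpose_mult_iff[OF svd' r a c(1)] by (simp add: B'_eq p_def)
    moreover have "- (col B' q \<bullet> ?a + ?b $ q) = c $ q" if "q < p" for q
      using c(1) that by simp
    ultimately show ?R using c by (intro bexI[of _ ?a] bexI[of _ ?b]) auto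
  next
    assume ?R
    then obtain a b where a: "a \<in> subdifferential n \<psi> u" and b: "b \<in> mat_kernel (transpose_mat B)"
      and tail: "\<forall>i \<in> {..<p + n - r} - {..<p}. col B' i \<bullet> a = 0"
      and sub: "\<forall>q<p. abs_subgradient (w q) ((B *\<^sub>v u) $ q) (- (col B' q \<bullet> a + b $ q))"
      by blast
    define c where "c = vec p (\<lambda>q. - (col B' q \<bullet> a + b $ q))"
    have a': "a \<in> carrier_vec n" using a by (simp add: subdifferential_def)
    have c: "c \<in> carrier_vec p" by (simp add: c_def)
    have "b \<in> carrier_vec p" using mat_kernelD(1)[OF BT b] .
    then have "- (c + vec p (\<lambda>q. col B' q \<bullet> a)) = b"
      by (intro eq_vecI) (auto simp: c_def)
    then have "a = - (transpose_mat B *\<^sub>v c)"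
      using eq_uminus_transpose_mult_iff[OF svd' r a' c] tail b by (simp add: B'_eq p_def)
    then show ?L using a sub c by (intro bexI[of _ c]) (auto simp: c_def)
  qed
  finally show ?thesis unfolding signs unfolding abs_minus_cancel p_def .
qed

end
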